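(* Let $n\geq 1$ and let $\theta$ be a reflexive and transitive binary relation on $\{1,2,\ldots,n\}$. If $R$ is a commutative ring and $A\in M_{n}(\theta,R)$, then $\mathrm{adj}(A)\in M_{n}(\theta,R)$.
   Context: All rings are associative with identity. $M_n(R)$ is the ring of $n\times n$ matrices over $R$. For a reflexive and transitive relation $\theta$ on $\{1,\ldots,n\}$, the structural matrix ring is the subring $M_{n}(\theta,R)=\{[a_{i,j}]\in M_{n}(R)\mid a_{i,j}=0\text{ if }(i,j)\notin\theta\}$ of $M_n(R)$. For $A=[a_{i,j}]\in M_n(R)$ over a commutative ring, $\mathrm{adj}(A)=[b_{r,s}]$ is the classical adjoint (adjugate) matrix, $b_{r,s}=\sum_{\rho\in S_n,\ \rho(s)=r}\mathrm{sgn}(\rho)\,a_{1,\rho(1)}\cdots a_{s-1,\rho(s-1)}a_{s+1,\rho(s+1)}\cdots a_{n,\rho(n)}$. *)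

theory Defs
  imports "Jordan_Normal_Form.Determinant"
begin

text \<open>
  Row and column indices run over \<open>{0..<n}\<close> instead of \<open>{1..n}\<close>, as usual for the type
  \<open>'a mat\<close>.  The sort \<open>{comm_ring, comm_monoid_mult}\<close> describes commutative rings with
  identity; unlike \<open>comm_ring_1\<close> it does not exclude the zero ring.
\<close>

definition structural_mat :: "nat \<Rightarrow> (nat \<times> nat) set \<Rightarrow> 'a :: zero mat set" where
  "structural_mat n \<theta> =
     {A \<in> carrier_mat n n. \<forall>i<n. \<forall>j<n. (i, j) \<notin> \<theta> \<longrightarrow> A $$ (i, j) = 0}"

text \<open>
  The sign is written with \<open>evenperm\<close> because \<open>of_int\<close>, and with it \<open>signof\<close>, needs
  \<open>ring_1\<close>.  The lemma below shows that over nontrivial rings this is the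
  adjugate \<open>adj_mat\<close> of the library.
\<close>

definition adjugate :: "'a :: {comm_ring, comm_monoid_mult} mat \<Rightarrow> 'a mat" where
  "adjugate A = mat (dim_row A) (dim_row A) (\<lambda>(r, s).
     \<Sum>\<rho> | \<rho> permutes {0..<dim_row A} \<and> \<rho> s = r.
       (if evenperm \<rho> then 1 else - 1) * (\<Prod>i\<in>{0..<dim_row A} - {s}. A $$ (i, \<rho> i)))"

lemma adjugate_eq_adj_mat:
  fixes A :: "'a :: comm_ring_1 mat"
  assumes A: "A \<in> carrier_mat n n"
  shows "adjugate A = adj_mat A"
proof (rule eq_matI)
  show "dim_row (adjugate A) = dim_row (adj_mat A)" "dim_col (adjugate A) = dim_col (adj_mat A)"
    using A by (auto simp: adjugate_def adj_mat_def)
next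
  fix r s assume "r < dim_row (adj_mat A)" "s < dim_col (adj_mat A)"
  then have r: "r < n" and s: "s < n" using A by (auto simp: adj_mat_def)
  define B where "B = mat n n (\<lambda>(i, j). if i = s then (if j = r then 1 else 0) else A $$ (i, j))"
  have B: "B \<in> carrier_mat n n" by (simp add: B_def)
  have del: "mat_delete B s j = mat_delete A s j" for j
    using A by (intro eq_matI) (auto simp: B_def mat_delete_def)
  have "det B = (\<Sum>j<n. B $$ (s, j) * cofactor B s j)"
    by (rule laplace_expansion_row[OF B s])
  also have "\<dots> = (\<Sum>j<n. if j = r then cofactor A s j else 0)"
  proof (rule sum.cong)
    fix j assume "j \<in> {..<n}"
    then have "B $$ (s, j) = (if j = r then 1 else 0)" using s by (simp add: B_def)
    then show "B $$ (s, j) * cofactor B s j = (if j = r then cofactor A s j else 0)"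
      by (simp add: cofactor_def del)
  qed simp
  also have "\<dots> = cofactor A s r" using r by simp
  finally have 1: "det B = cofactor A s r" .
  have prod: "(\<Prod>i = 0..<n. B $$ (i, p i)) =
      (if p s = r then \<Prod>i\<in>{0..<n} - {s}. A $$ (i, p i) else 0)"
    if "p permutes {0..<n}" for p
  proof -
    have lt: "i < n \<Longrightarrow> p i < n" for i using permutes_in_image[OF that, of i] by simp
    have "(\<Prod>i = 0..<n. B $$ (i, p i)) = B $$ (s, p s) * (\<Prod>i\<in>{0..<n} - {s}. B $$ (i, p i))"
      using s by (intro prod.remove) auto
    also have "(\<Prod>i\<in>{0..<n} - {s}. B $$ (i, p i)) = (\<Prod>i\<in>{0..<n} - {s}. A $$ (i, p i))"
      using lt by (intro prod.cong) (auto simp: B_def)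
    finally show ?thesis using s lt[OF s] by (simp add: B_def)
  qed
  have "det B = (\<Sum>p | p permutes {0..<n}.
      if p s = r then signof p * (\<Prod>i\<in>{0..<n} - {s}. A $$ (i, p i)) else 0)"
    unfolding det_def'[OF B] by (intro sum.cong) (auto simp: prod)
  also have "\<dots> = (\<Sum>p | p permutes {0..<n} \<and> p s = r.
      signof p * (\<Prod>i\<in>{0..<n} - {s}. A $$ (i, p i)))"
    by (subst sum.inter_filter[symmetric]) (auto simp: finite_permutations)
  finally have "cofactor A s r = \<dots>" using 1 by simp
  then show "adjugate A $$ (r, s) = adj_mat A $$ (r, s)"
    using A r s by (auto simp: adjugate_def adj_mat_def sign_def intro!: sum.cong)
qed

end

theory Submission
  imports Defs
begin

text \<open>
  The entry of the adjugate at \<open>(r, s)\<close> is a signed sum, over the permutations \<open>\<rho>\<close> with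
  \<open>\<rho> s = r\<close>, of products of the entries at \<open>(i, \<rho> i)\<close> with \<open>i \<noteq> s\<close>.  Such a product can be
  nonzero only if each arrow \<open>i \<rightarrow> \<rho> i\<close> with \<open>i \<noteq> s\<close> belongs to \<open>\<theta>\<close>.  These arrows contain
  the cycle of \<open>\<rho>\<close> through \<open>s\<close> with the arrow \<open>s \<rightarrow> r\<close> removed, which is a path from \<open>r\<close>
  to \<open>s\<close>; hence \<open>(r, s) \<in> \<theta>\<close> by transitivity, or by reflexivity if \<open>r = s\<close>.  So for
  \<open>(r, s) \<notin> \<theta>\<close> every summand vanishes (\<open>permutation_closes_up\<close>).
\<close>

text \<open>
  The path can be followed without iterating \<open>\<rho>\<close>.  If \<open>s\<close> is not \<open>\<theta>\<close>-above \<open>\<rho> s\<close>, then \<open>\<rho>\<close>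
  maps the finite set of all elements \<open>\<theta>\<close>-above \<open>\<rho> s\<close> injectively into itself, hence onto
  itself.  As \<open>\<rho> s\<close> lies in this set, so does its only preimage \<open>s\<close>.
\<close>

lemma permutation_closes_up:
  assumes perm: "\<rho> permutes S" and fin: "finite S" and sub: "\<theta> \<subseteq> S \<times> S"
    and refl: "refl_on S \<theta>" and trans: "trans \<theta>" and s: "s \<in> S"
    and step: "\<And>i. i \<in> S - {s} \<Longrightarrow> (i, \<rho> i) \<in> \<theta>"
  shows "(\<rho> s, s) \<in> \<theta>"
proof (rule ccontr)
  assume notin: "(\<rho> s, s) \<notin> \<theta>"
  define U where "U = {j. (\<rho> s, j) \<in> \<theta>}"
  have "U \<subseteq> S" using sub by (auto simp: U_def)
  then have "finite U" using fin finite_subset by blast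
  have inj: "inj \<rho>" using perm by (rule permutes_inj)
  have "\<rho> ` U \<subseteq> U"
  proof
    fix j assume "j \<in> \<rho> ` U"
    then obtain i where i: "i \<in> U" "j = \<rho> i" by blast
    then have "i \<in> S - {s}" using \<open>U \<subseteq> S\<close> notin by (auto simp: U_def)
    then have "(i, \<rho> i) \<in> \<theta>" by (rule step)
    then show "j \<in> U" using i trans by (auto simp: U_def dest: transD)
  qed
  with \<open>finite U\<close> have "\<rho> ` U = U"
    using inj by (intro endo_inj_surj) (auto intro: inj_on_subset)
  moreover have "\<rho> s \<in> U"
    using refl s permutes_in_image[OF perm] by (auto simp: U_def dest: refl_onD)
  ultimately have "s \<in> U" using inj by (metis inj_image_mem_iff)
  with notin show False by (simp add: U_def)
qed

text \<open>
  The sort admits the zero ring, whereas \<open>prod_zero\<close> assumes \<open>0 \<noteq> 1\<close>.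
\<close>

lemma prod_eq_0_if_factor_eq_0:
  fixes f :: "'b \<Rightarrow> 'a :: {comm_ring, comm_monoid_mult}"
  assumes "finite I" and "i \<in> I" and "f i = 0"
  shows "prod f I = 0"
  using assms by (simp add: prod.remove)

theorem corollary3p7:
  fixes n :: nat and \<theta> :: "(nat \<times> nat) set"
    and A :: "'a :: {comm_ring, comm_monoid_mult} mat"
  assumes "n \<ge> 1"
    and "\<theta> \<subseteq> {0..<n} \<times> {0..<n}"
    and "refl_on {0..<n} \<theta>"
    and "trans \<theta>"
    and "A \<in> structural_mat n \<theta>"
  shows "adjugate A \<in> structural_mat n \<theta>"
proof -
  have dim: "dim_row A = n"
    and zero: "\<And>i j. i < n \<Longrightarrow> j < n \<Longrightarrow> (i, j) \<notin> \<theta> \<Longrightarrow> A $$ (i, j) = 0"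
    using assms(5) by (auto simp: structural_mat_def)
  have "adjugate A $$ (r, s) = 0" if r: "r < n" and s: "s < n" and rs: "(r, s) \<notin> \<theta>" for r s
  proof -
    have "(\<Prod>i\<in>{0..<n} - {s}. A $$ (i, \<rho> i)) = 0"
      if \<rho>: "\<rho> permutes {0..<n}" "\<rho> s = r" for \<rho>
    proof -
      have "(\<rho> s, s) \<notin> \<theta>" using rs \<rho> by simp
      then obtain i where i: "i \<in> {0..<n} - {s}" "(i, \<rho> i) \<notin> \<theta>"
        using permutation_closes_up[OF \<rho>(1) _ assms(2-4), of s] s by auto
      then have "A $$ (i, \<rho> i) = 0"
        using permutes_in_image[OF \<rho>(1), of i] by (intro zero) auto
      with i(1) show ?thesis by (intro prod_eq_0_if_factor_eq_0) auto
    qed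
    then show ?thesis using r s by (simp add: adjugate_def dim)
  qed
  then show ?thesis by (auto simp: structural_mat_def adjugate_def dim)
qed

end
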